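(* Let $\alpha\in(0,1)$ and let $VaR\beta_\alpha(X)$ be the Beta-Kotz Value-at-Risk at level $\alpha$ of a random variable $X$ having the Beta-Kotz distribution with parameters $(a,b)$. Put $$Q=\left(\alpha-\sqrt{-(-1+\alpha)\alpha^2}\right)^{\frac13},\quad R=\left(\alpha-\sqrt{-(-1+\alpha)\alpha}\right)^{\frac13},\quad S=(-1+\sqrt\alpha)^{\frac23},\quad P=(1+\sqrt\alpha)^{\frac13}.$$ 1. For $b=2$, $VaR\beta_\alpha(X)$ is determined by: (i) if $a=b-1$, then $VaR\beta_\alpha(X)=1-\sqrt{1-\alpha}$; (ii) if $a=b$, then $$VaR\beta_\alpha(X)=\frac12-\frac12\left(-1+2\alpha+2\sqrt{\alpha^2-\alpha}\right)^{\frac13}-\frac12\left(-1+2\alpha+2\sqrt{\alpha^2-\alpha}\right)^{-\frac13};$$ (iii) if $a=b+1$, then $$VaR\beta_\alpha(X)=\frac16\left[2+\sqrt{4+\frac{6(\alpha+Q^2)}{R}}-\sqrt2\,\sqrt{4-\frac{3\alpha}{Q}}\right]+\frac16\left[-3Q+\frac{4\sqrt2}{\sqrt{2+\frac{3(\alpha+R^2)}{R}}}\right].$$ 2. For $b=3$, $VaR\beta_\alpha(X)$ is determined by: (i) if $a=b-2$, then $VaR\beta_\alpha(X)=1+\sqrt[3]{\alpha-1}$; (ii) if $a=b-1$, then $$VaR\beta_\alpha(X)=\frac23+\frac12\sqrt{\frac89+\frac{16}{27\sqrt{\frac49+\frac23SP+\frac{2(1-\alpha)}{3SP}}}-\frac23SP-\frac{2(1-\alpha)}{3SP}}-\frac12\sqrt{\frac49+\frac23SP+\frac{2(1-\alpha)}{3SP}}.$$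 3. For $b=4$ and $a=b-3$, $VaR\beta_\alpha(X)=1-\sqrt[4]{1-\alpha}$. 4. For $b=1$ and $a=b+n$ with $n\in\{0,1,2,\dots\}$, $VaR\beta_\alpha(X)=\sqrt[n+1]{\alpha}$.
   Context: For $a,b>0$, the Beta-Kotz distribution with parameters $(a,b)$ is the distribution on $(0,1)$ with density $\frac{\Gamma(a+b)}{\Gamma(a)\Gamma(b)}x^{a-1}(1-x)^{b-1}$ (in the original parametrization $a=t_1+\frac{n_1}{2}-1$ and $b=t_2+\frac{n_2}{2}-1$). Its Value-at-Risk at level $\alpha\in(0,1)$ is the number $v=VaR\beta_\alpha(X)\in(0,1)$ with $P(X\le v)=\alpha$. When $b$ is a positive integer, $v$ is the zero in $(0,1)$ of $$\frac{\Gamma(a+b)}{\Gamma(a)}\sum_{k=0}^{b-1}\frac{(-1)^k}{k!\,(a+k)\,\Gamma(b-k)}\,v^{a+k}-\alpha=0 .$$ In part 2, cube roots and the power $\frac23$ of negative real numbers are the real ones.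
   Formalization: In 1(iii) the printed formula fails (R=0 at α=1/2; limit (5−√2)/6, not 1, as α→1): R is taken equal to Q, and −3Q+4√2/√(2+3(α+R²)/R) is moved under the root with 4−3α/Q. In 1(ii) the cube root is e^{−2πi/3} times the principal one. *)

theory Defs
  imports "HOL-Probability.Probability"
begin

definition beta_kotz_density :: "real \<Rightarrow> real \<Rightarrow> real \<Rightarrow> real" where
  "beta_kotz_density a b x =
     (if 0 < x \<and> x < 1
      then Gamma (a + b) / (Gamma a * Gamma b) * x powr (a - 1) * (1 - x) powr (b - 1)
      else 0)"

definition beta_kotz_distributed ::
  "'w measure \<Rightarrow> ('w \<Rightarrow> real) \<Rightarrow> real \<Rightarrow> real \<Rightarrow> bool" where
  "beta_kotz_distributed M X a b \<longleftrightarrow>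
     distributed M lborel X (\<lambda>x. ennreal (beta_kotz_density a b x))"

definition VaR_beta :: "'w measure \<Rightarrow> ('w \<Rightarrow> real) \<Rightarrow> real \<Rightarrow> real" where
  "VaR_beta M X \<alpha> =
     (THE v. 0 < v \<and> v < 1 \<and> measure M {\<omega> \<in> space M. X \<omega> \<le> v} = \<alpha>)"

text \<open>For \<open>a = b = 2\<close> the Value-at-Risk solves the cubic \<open>3 v^2 - 2 v^3 = \<alpha>\<close> in the irreducible
  case: Cardano's radicand \<open>-1 + 2 \<alpha> + 2 csqrt (\<alpha>^2 - \<alpha>)\<close> is a non-real complex number of
  modulus 1 with argument in \<open>(0, pi)\<close>. Its three cube roots give the three real roots of the
  cubic, and the principal one gives the root in \<open>(-1/2, 0)\<close>. The root in \<open>(0, 1)\<close> belongs to the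
  following branch, the one of the logarithm with imaginary part in \<open>(-3 pi, -pi]\<close>.\<close>

definition cardano_cbrt :: "complex \<Rightarrow> complex" where
  "cardano_cbrt z = cis (- (2 * pi / 3)) * z powr (1 / 3)"

definition rad_Q :: "real \<Rightarrow> real" where
  "rad_Q \<alpha> = root 3 (\<alpha> - sqrt (- (- 1 + \<alpha>) * \<alpha>\<^sup>2))"

text \<open>In the source the inner radicand of \<open>R\<close> reads \<open>- (- 1 + \<alpha>) * \<alpha>\<close>, without the square. That is
  a misprint: it makes \<open>R\<close> vanish at \<open>\<alpha> = 1/2\<close>, where the closed form for \<open>a = 3\<close>, \<open>b = 2\<close>
  divides by \<open>R\<close>. Ferrari's solution of \<open>4 v^3 - 3 v^4 = \<alpha>\<close> has the same cube root in both
  places, so that \<open>R\<close> coincides with \<open>Q\<close>.\<close>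

definition rad_R :: "real \<Rightarrow> real" where
  "rad_R \<alpha> = root 3 (\<alpha> - sqrt (- (- 1 + \<alpha>) * \<alpha>\<^sup>2))"

text \<open>The power \<open>2/3\<close> of a negative number is the square of its real cube root.\<close>

definition rad_S :: "real \<Rightarrow> real" where
  "rad_S \<alpha> = (root 3 (- 1 + sqrt \<alpha>))\<^sup>2"

definition rad_P :: "real \<Rightarrow> real" where
  "rad_P \<alpha> = root 3 (1 + sqrt \<alpha>)"

text \<open>In the source the closed form for \<open>a = 3\<close>, \<open>b = 2\<close> closes the last square root after
  \<open>4 - 3 \<alpha> / Q\<close> and adds \<open>(- 3 Q + 4 sqrt 2 / sqrt (2 + 3 (\<alpha> + R^2) / R)) / 6\<close> separately. In
  Ferrari's solution these terms belong under that square root, and the theorem places them there.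
  Outside of it the expression tends to \<open>(5 - sqrt 2) / 6\<close> instead of 1 as \<open>\<alpha>\<close> tends to 1.\<close>

end

theory Submission
  imports Defs
begin

text \<open>For integer parameters the distribution function is a polynomial \<open>F\<close>, strictly increasing on
  \<open>[0, 1]\<close>, so it suffices to check that each closed form lies in \<open>(0, 1)\<close> and solves \<open>F v = \<alpha>\<close>.
  For \<open>a = b = 2\<close> write Cardano's radicand as \<open>cis \<theta>\<close> and use the triple angle formula. The two
  quartics are exchanged by \<open>v \<mapsto> 1 - v\<close>, \<open>\<alpha> \<mapsto> 1 - \<alpha>\<close>. Ferrari's resolvent is
  \<open>y\<^sup>3 = 3 \<alpha> y + 2 \<alpha>\<close> with the root \<open>y = Q + \<alpha> / Q\<close>, and in terms of \<open>t = sqrt (4 + 6 y)\<close> the inner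
  radicand factors as \<open>(4 - t) (t + 2)\<^sup>2 / t\<close>.\<close>

section \<open>The distribution function for integer parameters\<close>

text \<open>Writing the parameters as successors turns the Gamma factors into factorials and the
  real powers into natural ones. The density then extends to a polynomial, and the fundamental
  theorem of calculus evaluates its integral from 0 to \<open>v\<close>.\<close>

lemma prob_le_beta_kotz:
  fixes F :: "real \<Rightarrow> real"
  assumes dist: "beta_kotz_distributed M X (real (Suc m)) (real (Suc n))"
    and F: "\<And>x. (F has_real_derivative
              fact (Suc (m + n)) / (fact m * fact n) * x ^ m * (1 - x) ^ n) (at x)"
    and F0: "F 0 = 0" and v: "0 < v" "v < 1"
  shows "measure M {\<omega> \<in> space M. X \<omega> \<le> v} = F v"
proof -
  define c :: real where "c = fact (Suc (m + n)) / (fact m * fact n)"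
  define f where "f x = c * x ^ m * (1 - x) ^ n" for x :: real
  have c: "c > 0" by (simp add: c_def)
  have Gamma_c:
    "Gamma (real (Suc m) + real (Suc n)) / (Gamma (real (Suc m)) * Gamma (real (Suc n))) = c"
    using Gamma_fact[of m, where 'a = real] Gamma_fact[of n, where 'a = real]
      Gamma_fact[of "Suc (m + n)", where 'a = real]
    by (simp add: c_def algebra_simps)
  have dens: "beta_kotz_density (real (Suc m)) (real (Suc n)) x = f x" if "0 < x" "x < 1" for x
    using that by (simp add: beta_kotz_density_def Gamma_c powr_realpow f_def del: of_nat_Suc)
      (simp add: powr_realpow)
  have derF: "(F has_real_derivative f x) (at x)" for x
    using F[of x] by (simp add: f_def c_def)
  have "emeasure M {\<omega> \<in> space M. X \<omega> \<le> v} = emeasure M (X -` {..v} \<inter> space M)"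
    by (rule arg_cong[where f = "emeasure M"]) auto
  also have "\<dots> = (\<integral>\<^sup>+x. ennreal (beta_kotz_density (real (Suc m)) (real (Suc n)) x)
                     * indicator {..v} x \<partial>lborel)"
    using dist by (intro distributed_emeasure) (auto simp: beta_kotz_distributed_def)
  \<comment> \<open>The two integrands can differ only at 0, where the density is 0 but
    \<open>f 0 = c\<close> if \<open>m = 0\<close>.\<close>
  also have "\<dots> = (\<integral>\<^sup>+x. ennreal (f x) * indicator {0..v} x \<partial>lborel)"
  proof (rule nn_integral_cong_AE)
    show "AE x in lborel. ennreal (beta_kotz_density (real (Suc m)) (real (Suc n)) x)
             * indicator {..v} x = ennreal (f x) * indicator {0..v} x"
      using AE_lborel_singleton[of 0]
    proof eventually_elim
      case (elim x)
      show ?case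
      proof (cases "0 < x \<and> x \<le> v")
        case True
        then show ?thesis using v dens[of x] by simp
      next
        case False
        then show ?thesis using elim
          by (auto simp: beta_kotz_density_def indicator_def)
      qed
    qed
  qed
  also have "\<dots> = ennreal (F v - F 0)"
  proof (rule nn_integral_FTC_Icc)
    show "f \<in> borel_measurable borel" unfolding f_def by measurable
    show "0 \<le> f x" if "x \<in> {0..v}" for x
      using that v c by (simp add: f_def)
  qed (use v derF in auto)
  finally have "emeasure M {\<omega> \<in> space M. X \<omega> \<le> v} = ennreal (F v)" by (simp add: F0)
  \<comment> \<open>\<open>ennreal\<close> truncates negative numbers to 0, so \<open>F v\<close>
    must be nonnegative to be recovered from \<open>ennreal (F v)\<close>.\<close>
  moreover have "F 0 \<le> F v"
  proof (rule DERIV_nonneg_imp_nondecreasing[of 0 v F])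
    show "\<exists>y. (F has_real_derivative y) (at x) \<and> 0 \<le> y" if "0 \<le> x" "x \<le> v" for x
      using derF[of x] that v c by (auto simp: f_def intro!: exI[of _ "f x"])
  qed (use v in auto)
  ultimately show ?thesis by (simp add: measure_def F0)
qed

text \<open>The derivative of \<open>F\<close> is positive inside the unit interval, so the level
  set there has at most one point and the definite description is met by any solution of
  \<open>F v = \<alpha>\<close>.\<close>

lemma VaR_beta_eqI:
  fixes F :: "real \<Rightarrow> real"
  assumes dist: "beta_kotz_distributed M X (real (Suc m)) (real (Suc n))"
    and F: "\<And>x. (F has_real_derivative
              fact (Suc (m + n)) / (fact m * fact n) * x ^ m * (1 - x) ^ n) (at x)"
    and F0: "F 0 = 0" and v: "0 < v" "v < 1" "F v = \<alpha>"
  shows "VaR_beta M X \<alpha> = v"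
  unfolding VaR_beta_def
proof (rule the_equality)
  note cdf = prob_le_beta_kotz[OF dist F F0]
  show "0 < v \<and> v < 1 \<and> measure M {\<omega> \<in> space M. X \<omega> \<le> v} = \<alpha>"
    using v cdf by simp
  have less: "F x < F y" if "0 < x" "x < y" "y < 1" for x y
  proof (rule DERIV_pos_imp_increasing[OF \<open>x < y\<close>])
    show "\<exists>d. (F has_real_derivative d) (at z) \<and> 0 < d" if "x \<le> z" "z \<le> y" for z
      using that \<open>0 < x\<close> \<open>y < 1\<close>
      by (intro exI[of _ "fact (Suc (m + n)) / (fact m * fact n) * z ^ m * (1 - z) ^ n"]
          conjI F mult_pos_pos) auto
  qed
  fix u assume u: "0 < u \<and> u < 1 \<and> measure M {\<omega> \<in> space M. X \<omega> \<le> u} = \<alpha>"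
  then have "F u = F v" using cdf[of u] v by simp
  then show "u = v" using less[of u v] less[of v u] u v by (cases u v rule: linorder_cases) auto
qed

section \<open>Polynomial equations for the individual parameter pairs\<close>

lemma VaR_beta_left_param_1:
  assumes "beta_kotz_distributed M X 1 (real (Suc n))" and \<alpha>: "0 < \<alpha>" "\<alpha> < 1"
  shows "VaR_beta M X \<alpha> = 1 - root (Suc n) (1 - \<alpha>)"
proof (rule VaR_beta_eqI[where m = 0 and n = n and F = "\<lambda>x. 1 - (1 - x) ^ Suc n"])
  show "((\<lambda>x. 1 - (1 - x) ^ Suc n) has_real_derivative
      fact (Suc (0 + n)) / (fact 0 * fact n) * x ^ 0 * (1 - x) ^ n) (at x)" for x :: real
    by (auto intro!: derivative_eq_intros simp del: power_Suc)
  show "1 - (1 - (1 - root (Suc n) (1 - \<alpha>))) ^ Suc n = \<alpha>"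
    using \<alpha> real_root_pow_pos[of "Suc n" "1 - \<alpha>"] by (simp del: power_Suc)
qed (use assms in auto)

lemma VaR_beta_right_param_1:
  assumes "beta_kotz_distributed M X (real (Suc n)) 1" and \<alpha>: "0 < \<alpha>" "\<alpha> < 1"
  shows "VaR_beta M X \<alpha> = root (Suc n) \<alpha>"
proof (rule VaR_beta_eqI[where m = n and n = 0 and F = "\<lambda>x. x ^ Suc n"])
  show "((\<lambda>x. x ^ Suc n) has_real_derivative
      fact (Suc (n + 0)) / (fact n * fact 0) * x ^ n * (1 - x) ^ 0) (at x)" for x :: real
    by (auto intro!: derivative_eq_intros simp del: power_Suc)
  show "root (Suc n) \<alpha> ^ Suc n = \<alpha>"
    using \<alpha> by (intro real_root_pow_pos) auto
qed (use assms in auto)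

lemma VaR_beta_2_2:
  assumes "beta_kotz_distributed M X 2 2" and "0 < v" "v < 1" "3 * v ^ 2 - 2 * v ^ 3 = \<alpha>"
  shows "VaR_beta M X \<alpha> = v"
proof (rule VaR_beta_eqI[where m = 1 and n = 1 and F = "\<lambda>x. 3 * x ^ 2 - 2 * x ^ 3"])
  show "((\<lambda>x. 3 * x ^ 2 - 2 * x ^ 3) has_real_derivative
      fact (Suc (1 + 1)) / (fact 1 * fact 1) * x ^ 1 * (1 - x) ^ 1) (at x)" for x :: real
    by (auto intro!: derivative_eq_intros simp: fact_numeral eval_nat_numeral algebra_simps)
qed (use assms in auto)

lemma VaR_beta_3_2:
  assumes "beta_kotz_distributed M X 3 2" and "0 < v" "v < 1" "4 * v ^ 3 - 3 * v ^ 4 = \<alpha>"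
  shows "VaR_beta M X \<alpha> = v"
proof (rule VaR_beta_eqI[where m = 2 and n = 1 and F = "\<lambda>x. 4 * x ^ 3 - 3 * x ^ 4"])
  show "((\<lambda>x. 4 * x ^ 3 - 3 * x ^ 4) has_real_derivative
      fact (Suc (2 + 1)) / (fact 2 * fact 1) * x ^ 2 * (1 - x) ^ 1) (at x)" for x :: real
    by (auto intro!: derivative_eq_intros simp: fact_numeral eval_nat_numeral algebra_simps)
qed (use assms in auto)

text \<open>Reflection \<open>x \<mapsto> 1 - x\<close> exchanges the two parameters, so the quartic
  for parameters 3 and 2 can be reused at level \<open>1 - \<alpha>\<close>.\<close>

lemma VaR_beta_2_3:
  assumes "beta_kotz_distributed M X 2 3"
    and "0 < w" "w < 1" "4 * w ^ 3 - 3 * w ^ 4 = 1 - \<alpha>"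
  shows "VaR_beta M X \<alpha> = 1 - w"
proof (rule VaR_beta_eqI[where m = 1 and n = 2
      and F = "\<lambda>x. 1 - (4 * (1 - x) ^ 3 - 3 * (1 - x) ^ 4)"])
  show "((\<lambda>x. 1 - (4 * (1 - x) ^ 3 - 3 * (1 - x) ^ 4)) has_real_derivative
      fact (Suc (1 + 2)) / (fact 1 * fact 2) * x ^ 1 * (1 - x) ^ 2) (at x)" for x :: real
    by (auto intro!: derivative_eq_intros simp: fact_numeral eval_nat_numeral algebra_simps)
qed (use assms in auto)

section \<open>Cardano's cube root in the irreducible case\<close>

text \<open>The radicand is \<open>cis \<theta>\<close> with
  \<open>\<theta> = arccos (2 * \<alpha> - 1)\<close>, and the chosen branch gives
  \<open>\<phi> = (\<theta> - 2 * pi) / 3\<close>. The bound on \<open>cos \<phi>\<close> is what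
  places \<open>1 / 2 - cos \<phi>\<close> in the unit interval.\<close>

lemma cardano_cbrt_radicand:
  assumes \<alpha>: "0 < \<alpha>" "\<alpha> < 1"
  defines "w \<equiv> cardano_cbrt (- 1 + 2 * complex_of_real \<alpha>
                  + 2 * csqrt ((complex_of_real \<alpha>)\<^sup>2 - complex_of_real \<alpha>))"
  obtains \<phi> where "w = cis \<phi>" and "cos (3 * \<phi>) = 2 * \<alpha> - 1" and "\<bar>cos \<phi>\<bar> < 1 / 2"
proof
  define \<theta> where "\<theta> = arccos (2 * \<alpha> - 1)"
  have \<theta>: "0 < \<theta>" "\<theta> < pi" "cos \<theta> = 2 * \<alpha> - 1"
    using \<alpha> arccos_lt_bounded[of "2 * \<alpha> - 1"] by (auto simp: \<theta>_def)
  have pos: "0 < \<alpha> - \<alpha>\<^sup>2" using \<alpha> by (simp add: power2_eq_square)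
  have "(sin \<theta>)\<^sup>2 = (2 * sqrt (\<alpha> - \<alpha>\<^sup>2))\<^sup>2"
    unfolding sin_squared_eq \<theta>(3) power_mult_distrib
    using pos by (simp add: power2_eq_square algebra_simps)
  then have sin: "sin \<theta> = 2 * sqrt (\<alpha> - \<alpha>\<^sup>2)"
    using \<theta> pos by (auto intro!: power2_eq_imp_eq[OF _ sin_ge_zero])
  \<comment> \<open>On negative reals \<open>csqrt\<close> takes the root on the positive imaginary
    axis; this puts the radicand in the upper half plane, so its principal argument is
    \<theta>.\<close>
  have "csqrt ((complex_of_real \<alpha>)\<^sup>2 - complex_of_real \<alpha>) = \<i> * sqrt (\<alpha> - \<alpha>\<^sup>2)"
    using csqrt_of_real_nonpos[of "complex_of_real (\<alpha>\<^sup>2 - \<alpha>)"] pos by simp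
  then have z: "- 1 + 2 * complex_of_real \<alpha>
      + 2 * csqrt ((complex_of_real \<alpha>)\<^sup>2 - complex_of_real \<alpha>) = cis \<theta>"
    using \<theta> sin by (simp add: complex_eq_iff)
  have "Ln (cis \<theta>) = \<i> * \<theta>"
    using \<theta> by (simp add: cis_conv_exp Ln_exp)
  then have "cis \<theta> powr (1 / 3) = cis (\<theta> / 3)"
    by (simp add: powr_def cis_conv_exp)
  then show "w = cis (\<theta> / 3 - 2 * pi / 3)"
    unfolding w_def z cardano_cbrt_def by (simp add: cis_mult)
  have "3 * (\<theta> / 3 - 2 * pi / 3) = \<theta> - 2 * pi" by simp
  then show "cos (3 * (\<theta> / 3 - 2 * pi / 3)) = 2 * \<alpha> - 1"
    using \<theta> by (simp add: cos_diff)
  \<comment> \<open>The negated angle lies strictly between \<open>pi / 3\<close> and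
    \<open>2 * pi / 3\<close>, where cosine decreases from \<open>1 / 2\<close> to
    \<open>- 1 / 2\<close>.\<close>
  have "cos (2 * pi / 3 - \<theta> / 3) < cos (pi / 3)"
    using \<theta> by (intro cos_monotone_0_pi) auto
  moreover have "cos (2 * pi / 3) < cos (2 * pi / 3 - \<theta> / 3)"
    using \<theta> by (intro cos_monotone_0_pi) auto
  moreover have "cos (\<theta> / 3 - 2 * pi / 3) = cos (2 * pi / 3 - \<theta> / 3)"
    using cos_minus[of "\<theta> / 3 - 2 * pi / 3"] by simp
  ultimately show "\<bar>cos (\<theta> / 3 - 2 * pi / 3)\<bar> < 1 / 2"
    by (simp add: cos_60 cos_120 abs_less_iff)
qed

section \<open>Ferrari's solution of the quartic\<close>

text \<open>With \<open>e = sqrt ((4 - t) / t)\<close> all of \<open>t\<close>, \<open>w\<close> and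
  \<beta> become rational functions of \<open>e\<close>, so the nested radicals disappear and the
  quartic is a rational identity.\<close>

lemma quartic_root:
  fixes \<beta> y t w :: real
  assumes \<beta>: "0 < \<beta>" "\<beta> < 1" and y: "0 < y" "y ^ 3 = 3 * \<beta> * y + 2 * \<beta>"
  defines "t \<equiv> sqrt (4 + 6 * y)"
  defines "w \<equiv> (2 + t - sqrt (12 - t\<^sup>2 + 16 / t)) / 6"
  shows "0 < w" and "w < 1" and "4 * w ^ 3 - 3 * w ^ 4 = \<beta>"
proof -
  \<comment> \<open>For \<beta> equal to 1 the resolvent would be
    \<open>(y - 2) * (y + 1)^2 = 0\<close>; a smaller \<beta> pushes the positive root below 2. This
    yields \<open>t < 4\<close>, so that \<open>e\<close> is the root of a positive number.\<close>
  have y2: "y < 2"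
  proof (rule ccontr)
    assume "\<not> y < 2"
    then have "0 \<le> (y - 2) * (y + 1)\<^sup>2" by simp
    also have "(y - 2) * (y + 1)\<^sup>2 = y ^ 3 - 3 * y - 2"
      by (simp add: power2_eq_square power3_eq_cube algebra_simps)
    also have "\<dots> = (\<beta> - 1) * (3 * y + 2)" using y by (simp add: algebra_simps)
    also have "\<dots> < 0" using y \<beta> by (simp add: mult_neg_pos)
    finally show False by simp
  qed
  have t2: "t\<^sup>2 = 4 + 6 * y" using y by (simp add: t_def)
  have t: "2 < t" "t < 4"
    unfolding t_def using y y2 by (auto intro!: real_less_rsqrt real_less_lsqrt)
  define e where "e = sqrt ((4 - t) / t)"
  have e2: "e\<^sup>2 = (4 - t) / t" using t by (simp add: e_def)
  have e: "0 < e" "e < 1" using t by (auto simp: e_def)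
  have "12 - t\<^sup>2 + 16 / t = ((t + 2) * e)\<^sup>2"
    unfolding power_mult_distrib e2 using t by (simp add: field_simps power2_eq_square)
  then have "sqrt (12 - t\<^sup>2 + 16 / t) = (t + 2) * e"
    using t e by simp
  then have w: "w = (t + 2) * (1 - e) / 6" by (simp add: w_def algebra_simps)
  show "0 < w" using t e by (simp add: w)
  have "(t + 2) * (1 - e) < 6 * 1"
    using t e by (intro mult_strict_mono) auto
  then show "w < 1" by (simp add: w)
  have te: "t = 4 / (1 + e\<^sup>2)" using t by (simp add: e2 field_simps)
  have ne: "1 + e\<^sup>2 \<noteq> 0"
    using zero_le_power2[of e] by linarith
  have w': "w = (3 + e\<^sup>2) * (1 - e) / (3 * (1 + e\<^sup>2))"
    using ne by (simp add: w te field_simps)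
  \<comment> \<open>The resolvent is linear in \<beta>, and \<open>3 * y + 2\<close> is
    \<open>t^2 / 2\<close>; hence \<beta> is a rational function of \<open>t\<close>.\<close>
  have "\<beta> * (3 * y + 2) = y ^ 3" using y by (simp add: algebra_simps)
  moreover have y': "y = (t\<^sup>2 - 4) / 6" using t2 by simp
  ultimately have "\<beta> * (t\<^sup>2 / 2) = ((t\<^sup>2 - 4) / 6) ^ 3" by (simp add: field_simps)
  then have "\<beta> = (t\<^sup>2 - 4) ^ 3 / (108 * t\<^sup>2)" using t by (simp add: field_simps)
  also have "\<dots> = (4 / (1 + e\<^sup>2) ^ 2 - 1) ^ 3 * (1 + e\<^sup>2) ^ 2 / 27"
  proof -
    have t2: "t\<^sup>2 = 16 / (1 + e\<^sup>2)\<^sup>2" by (simp add: te power_divide)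
    then have "t\<^sup>2 - 4 = 4 * (4 / (1 + e\<^sup>2)\<^sup>2 - 1)" by simp
    then show ?thesis by (simp only: power_mult_distrib) (simp add: t2)
  qed
  also have "\<dots> = (4 - (1 + e\<^sup>2) ^ 2) ^ 3 / (27 * (1 + e\<^sup>2) ^ 4)"
  proof -
    have "(4 / g - 1) ^ 3 * g / 27 = (4 - g) ^ 3 / (27 * g\<^sup>2)" if "g \<noteq> 0" for g :: real
    proof -
      have "4 / g - 1 = (4 - g) / g" using that by (simp add: field_simps)
      then show ?thesis using that by (simp add: power_divide power2_eq_square power3_eq_cube)
    qed
    from this[of "(1 + e\<^sup>2)\<^sup>2"] show ?thesis using ne by simp
  qed
  also have "\<dots> = 4 * w ^ 3 - 3 * w ^ 4"
  proof -
    have "4 * w ^ 3 - 3 * w ^ 4 = w ^ 3 * (4 - 3 * w)" by (simp add: eval_nat_numeral algebra_simps)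
    also have "4 - 3 * w = (4 * (1 + e\<^sup>2) - (3 + e\<^sup>2) * (1 - e)) / (1 + e\<^sup>2)"
      using ne by (simp add: w' field_simps)
    also have "w ^ 3 * \<dots> = ((3 + e\<^sup>2) * (1 - e)) ^ 3 * (4 * (1 + e\<^sup>2) - (3 + e\<^sup>2) * (1 - e))
        / (27 * (1 + e\<^sup>2) ^ 4)"
    proof -
      have "(u / (3 * h)) ^ 3 * (d / h) = u ^ 3 * d / (27 * h ^ 4)" for u h d :: real
        by (simp add: power_divide power_mult_distrib eval_nat_numeral)
      then show ?thesis by (simp only: w')
    qed
    \<comment> \<open>This factor is a perfect cube. It combines with \<open>(1 - e) ^ 3\<close> to
      leave only even powers of \<open>e\<close>, as in the expression for \<beta>.\<close>
    also have "4 * (1 + e\<^sup>2) - (3 + e\<^sup>2) * (1 - e) = (1 + e) ^ 3"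
      by (simp add: power2_eq_square power3_eq_cube algebra_simps)
    also have "((3 + e\<^sup>2) * (1 - e)) ^ 3 * (1 + e) ^ 3 = ((3 + e\<^sup>2) * (1 - e) * (1 + e)) ^ 3"
      by (simp add: power_mult_distrib)
    also have "(3 + e\<^sup>2) * (1 - e) * (1 + e) = 4 - (1 + e\<^sup>2) ^ 2"
      by (simp add: power2_eq_square algebra_simps)
    finally show ?thesis by simp
  qed
  finally show "4 * w ^ 3 - 3 * w ^ 4 = \<beta>" by simp
qed

text \<open>Cardano's method: \<open>q\<close> and \<open>\<beta> / q\<close> have product \<beta>,
  and their cubes \<open>\<beta> * (1 - s)\<close> and \<open>\<beta> * (1 + s)\<close>, where
  \<open>s = sqrt (1 - \<beta>)\<close>, have sum \<open>2 * \<beta>\<close>. Expanding the cube of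
  the sum gives the resolvent.\<close>

lemma rad_Q_resolvent:
  assumes \<beta>: "0 < \<beta>" "\<beta> < 1"
  defines "q \<equiv> rad_Q \<beta>"
  defines "y \<equiv> q + \<beta> / q"
  shows "0 < q" and "0 < y" and "y ^ 3 = 3 * \<beta> * y + 2 * \<beta>"
proof -
  define s where "s = sqrt (1 - \<beta>)"
  have s: "0 < s" "s < 1" "s\<^sup>2 = 1 - \<beta>" using \<beta> by (auto simp: s_def)
  have "sqrt (- (- 1 + \<beta>) * \<beta>\<^sup>2) = s * \<beta>"
    using \<beta> by (simp add: s_def real_sqrt_mult del: minus_add_distrib)
  then have q_root: "q = root 3 (\<beta> * (1 - s))" by (simp add: q_def rad_Q_def algebra_simps)
  then show q: "0 < q" using \<beta> s by simp
  then show "0 < y" using \<beta> by (simp add: y_def add_pos_pos)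
  have q3: "q ^ 3 = \<beta> * (1 - s)" using \<beta> s by (simp add: q_root)
  have "(\<beta> / q) ^ 3 = \<beta> ^ 3 / (\<beta> * (1 - s))" by (simp add: power_divide q3)
  also have "\<dots> = \<beta> * (1 + s)"
  proof -
    have "\<beta> ^ 3 = \<beta> * (1 + s) * (\<beta> * (1 - s))" using s by algebra
    then show ?thesis using \<beta> s by simp
  qed
  finally have r3: "(\<beta> / q) ^ 3 = \<beta> * (1 + s)" .
  have "(q + r) ^ 3 = q ^ 3 + r ^ 3 + 3 * (q * r) * (q + r)" for r :: real
    by (simp add: power3_eq_cube algebra_simps)
  from this[of "\<beta> / q"] have "y ^ 3 = q ^ 3 + (\<beta> / q) ^ 3 + 3 * (q * (\<beta> / q)) * y"
    by (simp only: y_def)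
  then show "y ^ 3 = 3 * \<beta> * y + 2 * \<beta>" using q by (simp add: q3 r3 algebra_simps)
qed

text \<open>Both sides have cube \<open>(1 - \<alpha>) * (1 - sqrt \<alpha>)\<close>. The product of
  \<open>S\<close> and \<open>P\<close> is thus the Cardano cube root of the reflected
  quartic.\<close>

lemma rad_S_mult_rad_P:
  assumes "0 < \<alpha>" "\<alpha> < 1"
  shows "rad_S \<alpha> * rad_P \<alpha> = rad_Q (1 - \<alpha>)"
proof -
  have "(- 1 + sqrt \<alpha>)\<^sup>2 * (1 + sqrt \<alpha>) = (1 - \<alpha>) - sqrt (- (- 1 + (1 - \<alpha>)) * (1 - \<alpha>)\<^sup>2)"
  proof -
    have "sqrt (- (- 1 + (1 - \<alpha>)) * (1 - \<alpha>)\<^sup>2) = sqrt \<alpha> * (1 - \<alpha>)"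
      using assms by (simp add: real_sqrt_mult)
    moreover have "(sqrt \<alpha>)\<^sup>2 = \<alpha>" using assms by simp
    ultimately show ?thesis by algebra
  qed
  then show ?thesis
    by (simp add: rad_S_def rad_P_def rad_Q_def real_root_power[symmetric] real_root_mult[symmetric])
qed

section \<open>Matching the closed forms with the roots\<close>

theorem proposition5p1:
  fixes M :: "'w measure" and X :: "'w \<Rightarrow> real" and a b \<alpha> Q R S P :: real
  assumes "prob_space M"
    and "a > 0" and "b > 0"
    and "beta_kotz_distributed M X a b"
    and "0 < \<alpha>" and "\<alpha> < 1"
    and "Q = rad_Q \<alpha>" and "R = rad_R \<alpha>" and "S = rad_S \<alpha>" and "P = rad_P \<alpha>"
  shows
    "(b = 2 \<longrightarrow>
       (a = b - 1 \<longrightarrow> VaR_beta M X \<alpha> = 1 - sqrt (1 - \<alpha>)) \<and>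
       (a = b \<longrightarrow>
          complex_of_real (VaR_beta M X \<alpha>) =
            (let w = cardano_cbrt (- 1 + 2 * complex_of_real \<alpha>
                       + 2 * csqrt ((complex_of_real \<alpha>)\<^sup>2 - complex_of_real \<alpha>))
             in 1 / 2 - 1 / 2 * w - 1 / 2 * inverse w)) \<and>
       (a = b + 1 \<longrightarrow>
          VaR_beta M X \<alpha> =
            1 / 6 * (2 + sqrt (4 + 6 * (\<alpha> + Q\<^sup>2) / R)
              - sqrt 2 * sqrt (4 - 3 * \<alpha> / Q
                  + (- 3 * Q + 4 * sqrt 2 / sqrt (2 + 3 * (\<alpha> + R\<^sup>2) / R)))))) \<and>
     (b = 3 \<longrightarrow>
       (a = b - 2 \<longrightarrow> VaR_beta M X \<alpha> = 1 + root 3 (\<alpha> - 1)) \<and>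
       (a = b - 1 \<longrightarrow>
          VaR_beta M X \<alpha> =
            2 / 3
            + 1 / 2 * sqrt (8 / 9
                + 16 / (27 * sqrt (4 / 9 + 2 / 3 * S * P + 2 * (1 - \<alpha>) / (3 * S * P)))
                - 2 / 3 * S * P - 2 * (1 - \<alpha>) / (3 * S * P))
            - 1 / 2 * sqrt (4 / 9 + 2 / 3 * S * P + 2 * (1 - \<alpha>) / (3 * S * P)))) \<and>
     (b = 4 \<longrightarrow> a = b - 3 \<longrightarrow> VaR_beta M X \<alpha> = 1 - root 4 (1 - \<alpha>)) \<and>
     (\<forall>n::nat. b = 1 \<longrightarrow> a = b + real n \<longrightarrow> VaR_beta M X \<alpha> = root (n + 1) \<alpha>)"
proof -
  note dist = assms(4) and \<alpha> = assms(5,6)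
  have cubic: "complex_of_real (VaR_beta M X \<alpha>) =
      (let w = cardano_cbrt (- 1 + 2 * complex_of_real \<alpha>
                 + 2 * csqrt ((complex_of_real \<alpha>)\<^sup>2 - complex_of_real \<alpha>))
       in 1 / 2 - 1 / 2 * w - 1 / 2 * inverse w)" if "b = 2" "a = b"
  proof -
    obtain \<phi> where \<phi>: "cardano_cbrt (- 1 + 2 * complex_of_real \<alpha>
                 + 2 * csqrt ((complex_of_real \<alpha>)\<^sup>2 - complex_of_real \<alpha>)) = cis \<phi>"
      "cos (3 * \<phi>) = 2 * \<alpha> - 1" "\<bar>cos \<phi>\<bar> < 1 / 2"
      using cardano_cbrt_radicand[OF \<alpha>] .
    \<comment> \<open>Substituting \<open>v = 1 / 2 - c\<close> turns
      \<open>3 * v^2 - 2 * v^3\<close> into \<open>(1 + (4 * c^3 - 3 * c)) / 2\<close>, which for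
      \<open>c = cos \<phi>\<close> is \<open>(1 + cos (3 * \<phi>)) / 2\<close>.\<close>
    have "VaR_beta M X \<alpha> = 1 / 2 - cos \<phi>"
    proof (rule VaR_beta_2_2)
      show "3 * (1 / 2 - cos \<phi>)\<^sup>2 - 2 * (1 / 2 - cos \<phi>) ^ 3 = \<alpha>"
        using \<phi>(2) unfolding cos_treble_cos
        by (simp add: power2_eq_square power3_eq_cube algebra_simps)
    qed (use dist that \<phi> in auto)
    then show ?thesis
      unfolding Let_def \<phi>(1) cis_inverse by (simp add: complex_eq_iff)
  qed
  have quartic: "VaR_beta M X \<alpha> =
      1 / 6 * (2 + sqrt (4 + 6 * (\<alpha> + Q\<^sup>2) / R)
        - sqrt 2 * sqrt (4 - 3 * \<alpha> / Q
            + (- 3 * Q + 4 * sqrt 2 / sqrt (2 + 3 * (\<alpha> + R\<^sup>2) / R))))" if "b = 2" "a = b + 1"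
  proof -
    define y where "y = Q + \<alpha> / Q"
    define t where "t = sqrt (4 + 6 * y)"
    note Q = rad_Q_resolvent[OF \<alpha>, folded \<open>Q = rad_Q \<alpha>\<close>, folded y_def]
    note root = quartic_root[OF \<alpha> Q(2,3), folded t_def]
    have "R = Q" using assms(7,8) by (simp add: rad_Q_def rad_R_def)
    then have R: "6 * (\<alpha> + Q\<^sup>2) / R = 6 * y" "3 * (\<alpha> + R\<^sup>2) / R = 3 * y"
      using Q(1) by (auto simp: y_def field_simps power2_eq_square)
    have t: "t = sqrt 2 * sqrt (2 + 3 * y)" "0 < t" "t\<^sup>2 = 4 + 6 * y"
      using Q(2) by (auto simp: t_def real_sqrt_mult[symmetric])
    have "4 * sqrt 2 / sqrt (2 + 3 * y) = 8 / t"
      using Q(2) unfolding t(1) by (simp add: field_simps)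
    \<comment> \<open>The outer factor \<open>sqrt 2\<close> goes under the root as 2, and
      \<open>Q\<close> and \<open>\<alpha> / Q\<close> combine to \<open>y\<close>.\<close>
    then have "2 * (4 - 3 * \<alpha> / Q + (- 3 * Q + 4 * sqrt 2 / sqrt (2 + 3 * y)))
        = 12 - t\<^sup>2 + 16 / t"
      using t(3) by (simp add: y_def algebra_simps)
    then have "sqrt 2 * sqrt (4 - 3 * \<alpha> / Q + (- 3 * Q + 4 * sqrt 2 / sqrt (2 + 3 * y)))
        = sqrt (12 - t\<^sup>2 + 16 / t)"
      by (simp only: real_sqrt_mult[symmetric])
    moreover have "VaR_beta M X \<alpha> = (2 + t - sqrt (12 - t\<^sup>2 + 16 / t)) / 6"
      using dist that root by (intro VaR_beta_3_2) auto
    ultimately show ?thesis unfolding R by (simp add: t_def)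
  qed
  have reflected: "VaR_beta M X \<alpha> =
      2 / 3
      + 1 / 2 * sqrt (8 / 9
          + 16 / (27 * sqrt (4 / 9 + 2 / 3 * S * P + 2 * (1 - \<alpha>) / (3 * S * P)))
          - 2 / 3 * S * P - 2 * (1 - \<alpha>) / (3 * S * P))
      - 1 / 2 * sqrt (4 / 9 + 2 / 3 * S * P + 2 * (1 - \<alpha>) / (3 * S * P))"
    if "b = 3" "a = b - 1"
  proof -
    define q where "q = rad_Q (1 - \<alpha>)"
    define y where "y = q + (1 - \<alpha>) / q"
    define t where "t = sqrt (4 + 6 * y)"
    have \<beta>: "0 < 1 - \<alpha>" "1 - \<alpha> < 1" using \<alpha> by auto
    note q = rad_Q_resolvent[OF \<beta>, folded q_def, folded y_def]
    note root = quartic_root[OF \<beta> q(2,3), folded t_def]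
    have SP: "S * P = q" using rad_S_mult_rad_P[OF \<alpha>] assms(9,10) by (simp add: q_def)
    have SP': "2 / 3 * S * P = 2 / 3 * q" "3 * S * P = 3 * q"
      using SP by (simp_all add: mult.assoc)
    \<comment> \<open>The radicands here are those of \<open>quartic_root\<close> divided by 9, so
      each root is scaled by \<open>1 / 3\<close>.\<close>
    have T: "4 / 9 + 2 / 3 * S * P + 2 * (1 - \<alpha>) / (3 * S * P) = (4 + 6 * y) / 9"
      "8 / 9 + u - 2 / 3 * S * P - 2 * (1 - \<alpha>) / (3 * S * P) = 8 / 9 + u - 2 / 3 * y" for u
      unfolding SP' y_def using q(1) by (simp_all add: field_simps)
    have t: "sqrt ((4 + 6 * y) / 9) = t / 3" "0 < t" "t\<^sup>2 = 4 + 6 * y"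
      using q(2) real_sqrt_abs[of 3] by (auto simp: t_def real_sqrt_divide)
    have "8 / 9 + 16 / (27 * (t / 3)) - 2 / 3 * y = (12 - t\<^sup>2 + 16 / t) / 3\<^sup>2"
      using t(3) by (simp add: field_simps)
    then have "sqrt (8 / 9 + 16 / (27 * (t / 3)) - 2 / 3 * y) = sqrt (12 - t\<^sup>2 + 16 / t) / 3"
      by (simp only: real_sqrt_divide real_sqrt_abs abs_numeral)
    moreover have "VaR_beta M X \<alpha> = 1 - (2 + t - sqrt (12 - t\<^sup>2 + 16 / t)) / 6"
      using dist that root by (intro VaR_beta_2_3) auto
    ultimately show ?thesis unfolding T t(1) by (simp add: field_simps)
  qed
  have left: "VaR_beta M X \<alpha> = 1 - root (Suc n) (1 - \<alpha>)" if "a = 1" "b = real (Suc n)" for n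
    using dist that \<alpha> by (intro VaR_beta_left_param_1) auto
  have right: "VaR_beta M X \<alpha> = root (n + 1) \<alpha>" if "b = 1" "a = b + real n" for n
    using dist that \<alpha> VaR_beta_right_param_1[of M X n \<alpha>] by (simp add: add.commute)
  \<comment> \<open>\<open>root 3\<close> is the real cube root, hence odd; this brings the form
    with \<open>\<alpha> - 1\<close> into that of \<open>left\<close>.\<close>
  have "root 3 (\<alpha> - 1) = - root 3 (1 - \<alpha>)"
    using real_root_minus[of 3 "1 - \<alpha>"] by simp
  moreover have "Suc 1 = 2" "Suc 2 = 3" "Suc 3 = 4" by simp_all
  ultimately show ?thesis
    using cubic quartic reflected left[of 1] left[of 2] left[of 3] right
    by (simp add: sqrt_def del: One_nat_def)
qed

end
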